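(* Let $\{i,j\}=\{1,2\}$ and let $(L,L_1,L_2)$ be a bilocale whose $j$-$G_\delta$-sublocales are complemented in $L$. The following statements are equivalent: (1) $(L,L_1,L_2)$ is $(i,j)$-Baire. (2) Each non-void $i$-open sublocale of $L$ is of $(j,i)$-second category. (3) Every sublocale of $L$ of $(j,i)$-first category has void $i$-interior. (4) The supplement $L\smallsetminus S$ of every sublocale $S$ of $L$ of $(j,i)$-first category is $i$-dense.
   Context: A locale is a complete lattice $L$ with $a\wedge\bigvee B=\bigvee\{a\wedge b:b\in B\}$ for all $a\in L$, $B\subseteq L$; $\to$ is its Heyting operation. A subframe of $L$ is a subset closed under all joins and finite meets. A bilocale is a triple $(L,L_1,L_2)$ with $L_1,L_2$ subframes of a locale $L$ such that $a=\bigvee\{a_1\wedge a_2:a_1\in L_1,a_2\in L_2,a_1\wedge a_2\le a\}$ for all $a\in L$. A sublocale of $L$ is a subset $S$ closed under all meets with $x\to s\in S$ for all $x\in L$, $s\in S$. Sublocales of $L$ ordered by inclusion form a coframe $\mathcal S(L)$ in which meets are intersections; joins $\bigvee$ of sublocales are taken in $\mathcal S(L)$. The smallest sublocale $\mathsf O=\{1\}$ is called void. A sublocale is complemented if it has a complement in $\mathcal S(L)$. The supplement of $S$ is $L\smallsetminus S=\bigvee\{T\in\mathcal S(L):T\cap S=\mathsf O\}$. For $a\in L$, $\mathfrak o(a)=\{a\to x:x\in L\}$ is an open sublocale and $\mathfrak c(a)=\{x\in L:a\le x\}$ a closed sublocale. For $k\in\{1,2\}$: a sublocale is $k$-open if it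 equals $\mathfrak o(a)$ for some $a\in L_k$; a $k$-$G_\delta$-sublocale is one of the form $\bigwedge_{n\in\mathbb N}\mathfrak o(x_n)$ with all $x_n\in L_k$; the $k$-closure and $k$-interior of $S$ are $\mathrm{cl}_k(S)=\bigcap\{\mathfrak c(a):a\in L_k,\ S\subseteq\mathfrak c(a)\}$ and $\mathrm{int}_k(S)=\bigvee\{\mathfrak o(a):a\in L_k,\ \mathfrak o(a)\subseteq S\}$; $S$ is $k$-dense if $\mathrm{cl}_k(S)=L$. The bilocale is $(i,j)$-Baire if the intersection of any countably many $i$-dense $j$-open sublocales is $i$-dense. A sublocale $S$ is $(j,i)$-nowhere dense if $\mathrm{int}_i(\mathrm{cl}_j(S))=\mathsf O$. A sublocale $S$ is of $(j,i)$-first category if $S\subseteq\bigvee_{n\in\mathbb N}S_n$ for some $(j,i)$-nowhere dense sublocales $S_n$, $n\in\mathbb N$; it is of $(j,i)$-second category if it is not of $(j,i)$-first category. *)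

theory Defs
  imports Main "HOL-Library.Countable_Set"
begin

(* The library class complete_distrib_lattice demands complete distributivity, which is
   stronger than the frame law. *)
class frame = complete_lattice +
  assumes inf_Sup_frame: "inf a (Sup B) = (SUP b\<in>B. inf a b)"

definition himp :: "'a::frame \<Rightarrow> 'a \<Rightarrow> 'a" where
  "himp a b = Sup {c. inf a c \<le> b}"

lemma le_himp_iff: "c \<le> himp a b \<longleftrightarrow> inf a c \<le> b"
proof
  assume "c \<le> himp a b"
  then have "inf a c \<le> inf a (himp a b)"
    by (rule inf_mono[OF order_refl])
  also have "\<dots> \<le> b"
    unfolding himp_def inf_Sup_frame by (rule SUP_least) simp
  finally show "inf a c \<le> b" .
next
  assume "inf a c \<le> b"
  then show "c \<le> himp a b"
    unfolding himp_def by (intro Sup_upper) simp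
qed

definition subframe :: "'a::frame set \<Rightarrow> bool" where
  "subframe M \<longleftrightarrow>
     (\<forall>A\<subseteq>M. Sup A \<in> M) \<and> (\<forall>A\<subseteq>M. finite A \<longrightarrow> Inf A \<in> M)"

(* The ambient locale is the whole type. *)
definition bilocale :: "'a::frame set \<Rightarrow> 'a set \<Rightarrow> bool" where
  "bilocale L1 L2 \<longleftrightarrow> subframe L1 \<and> subframe L2 \<and>
     (\<forall>a. a = Sup {inf a1 a2 | a1 a2. a1 \<in> L1 \<and> a2 \<in> L2 \<and> inf a1 a2 \<le> a})"

definition is_sublocale :: "'a::frame set \<Rightarrow> bool" where
  "is_sublocale S \<longleftrightarrow> (\<forall>A\<subseteq>S. Inf A \<in> S) \<and> (\<forall>x. \<forall>s\<in>S. himp x s \<in> S)"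

definition void :: "'a::frame set" where
  "void = {top}"

(* Joins of sublocales in the lattice of all sublocales ordered by inclusion;
   see is_sublocale_subl_Sup, subl_Sup_upper and subl_Sup_least. *)
definition subl_Sup :: "'a::frame set set \<Rightarrow> 'a set" where
  "subl_Sup \<S> = \<Inter>{T. is_sublocale T \<and> \<Union>\<S> \<subseteq> T}"

lemma is_sublocale_Inter:
  assumes "\<And>S. S \<in> \<S> \<Longrightarrow> is_sublocale S"
  shows "is_sublocale (\<Inter>\<S>)"
  using assms unfolding is_sublocale_def by (simp add: le_Inf_iff)

lemma is_sublocale_UNIV: "is_sublocale UNIV"
  by (simp add: is_sublocale_def)

lemma is_sublocale_void: "is_sublocale void"
proof -
  have "himp x top = top" for x :: 'a
    by (rule top_le) (simp add: le_himp_iff)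
  moreover have "Inf A = top" if "A \<subseteq> {top}" for A :: "'a set"
    using that by (auto simp: Inf_top_conv)
  ultimately show ?thesis
    by (simp add: is_sublocale_def void_def)
qed

lemma void_subset: "is_sublocale S \<Longrightarrow> void \<subseteq> S"
  unfolding is_sublocale_def void_def by (metis Inf_empty empty_subsetI insert_subset)

lemma is_sublocale_subl_Sup: "is_sublocale (subl_Sup \<S>)"
  unfolding subl_Sup_def by (rule is_sublocale_Inter) simp

lemma subl_Sup_upper: "S \<in> \<S> \<Longrightarrow> S \<subseteq> subl_Sup \<S>"
  unfolding subl_Sup_def by blast

lemma subl_Sup_least:
  "is_sublocale T \<Longrightarrow> (\<And>S. S \<in> \<S> \<Longrightarrow> S \<subseteq> T) \<Longrightarrow> subl_Sup \<S> \<subseteq> T"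
  unfolding subl_Sup_def by blast

definition complemented_sublocale :: "'a::frame set \<Rightarrow> bool" where
  "complemented_sublocale S \<longleftrightarrow> is_sublocale S \<and>
     (\<exists>T. is_sublocale T \<and> S \<inter> T = void \<and> subl_Sup {S, T} = UNIV)"

definition supplement :: "'a::frame set \<Rightarrow> 'a set" where
  "supplement S = subl_Sup {T. is_sublocale T \<and> T \<inter> S = void}"

definition open_subl :: "'a::frame \<Rightarrow> 'a set" where
  "open_subl a = {himp a x | x. True}"

definition closed_subl :: "'a::frame \<Rightarrow> 'a set" where
  "closed_subl a = {x. a \<le> x}"

(* In the following, M, Mi and Mj stand for one of the subframes L1 and L2 of a bilocale:
   k_open (L k) S says that S is k-open, and so on. *)

definition k_open :: "'a::frame set \<Rightarrow> 'a set \<Rightarrow> bool" where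
  "k_open M S \<longleftrightarrow> (\<exists>a\<in>M. S = open_subl a)"

definition k_Gdelta :: "'a::frame set \<Rightarrow> 'a set \<Rightarrow> bool" where
  "k_Gdelta M S \<longleftrightarrow> (\<exists>x::nat \<Rightarrow> 'a. range x \<subseteq> M \<and> S = (\<Inter>n. open_subl (x n)))"

definition k_closure :: "'a::frame set \<Rightarrow> 'a set \<Rightarrow> 'a set" where
  "k_closure M S = \<Inter>{closed_subl a | a. a \<in> M \<and> S \<subseteq> closed_subl a}"

definition k_interior :: "'a::frame set \<Rightarrow> 'a set \<Rightarrow> 'a set" where
  "k_interior M S = subl_Sup {open_subl a | a. a \<in> M \<and> open_subl a \<subseteq> S}"

definition k_dense :: "'a::frame set \<Rightarrow> 'a set \<Rightarrow> bool" where
  "k_dense M S \<longleftrightarrow> k_closure M S = UNIV"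

definition baire :: "'a::frame set \<Rightarrow> 'a set \<Rightarrow> bool" where
  "baire Mi Mj \<longleftrightarrow>
     (\<forall>\<S>. countable \<S> \<and> (\<forall>S\<in>\<S>. k_dense Mi S \<and> k_open Mj S) \<longrightarrow> k_dense Mi (\<Inter>\<S>))"

definition nowhere_dense :: "'a::frame set \<Rightarrow> 'a set \<Rightarrow> 'a set \<Rightarrow> bool" where
  "nowhere_dense Mj Mi S \<longleftrightarrow> is_sublocale S \<and> k_interior Mi (k_closure Mj S) = void"

definition first_category :: "'a::frame set \<Rightarrow> 'a set \<Rightarrow> 'a set \<Rightarrow> bool" where
  "first_category Mj Mi S \<longleftrightarrow> is_sublocale S \<and>
     (\<exists>N::nat \<Rightarrow> 'a set. (\<forall>n. nowhere_dense Mj Mi (N n)) \<and> S \<subseteq> subl_Sup (range N))"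

definition second_category :: "'a::frame set \<Rightarrow> 'a set \<Rightarrow> 'a set \<Rightarrow> bool" where
  "second_category Mj Mi S \<longleftrightarrow> is_sublocale S \<and> \<not> first_category Mj Mi S"

end

theory Submission
  imports Defs
begin

text \<open>
  Open and closed sublocales are complementary, so a sublocale is $(j,i)$-nowhere dense iff it lies
  in \<open>\<cc>(a)\<close> for some \<open>a\<close> in \<open>L\<^sub>j\<close> with \<open>\<oo>(a)\<close> $i$-dense. Thus a first category sublocale is one
  below a join of closed sublocales \<open>\<cc>(a\<^sub>n)\<close>, and this join is disjoint from the $G_\delta$-sublocale
  \<open>G = \<Inter>\<^sub>n \<oo>(a\<^sub>n)\<close> because \<open>G\<close> is complemented. Conversely, every sublocale disjoint from the join lies in
  \<open>G\<close>, so the supplement of the join lies in \<open>G\<close>. Finally \<open>S\<close> and its supplement always join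
  to \<open>L\<close>, which turns density of the supplement into voidness of the interior.
\<close>

section \<open>Arithmetic of the Heyting operation\<close>

lemma inf_himp_le: "inf a (himp a b) \<le> (b :: 'a::frame)"
  by (simp flip: le_himp_iff)

lemma le_himp: "b \<le> himp a (b :: 'a::frame)"
  by (simp add: le_himp_iff)

text \<open>An element of a poset is determined by the elements below it, and those below an
  implication are known by adjunction.\<close>

lemma himp_eqI:
  assumes "\<And>c. inf a c \<le> b \<longleftrightarrow> inf a' c \<le> b'"
  shows "himp a b = himp a' (b' :: 'a::frame)"
  using assms by (intro order.antisym) (metis le_himp_iff order_refl)+

lemma himp_himp: "himp a (himp b c) = himp (inf a b) (c :: 'a::frame)"
  by (rule himp_eqI) (simp add: le_himp_iff inf.left_commute inf.assoc)

lemma himp_inf: "himp a (inf b c) = inf (himp a b) (himp a (c :: 'a::frame))"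
proof (rule order.antisym)
  show "himp a (inf b c) \<le> inf (himp a b) (himp a c)"
    by (metis le_himp_iff le_inf_iff order_refl)
  show "inf (himp a b) (himp a c) \<le> himp a (inf b c)"
    by (metis le_himp_iff le_inf_iff order_refl inf.cobounded1 inf.cobounded2)
qed

lemma himp_Inf: "himp a (Inf B) = (INF b\<in>B. himp a (b :: 'a::frame))"
proof (rule order.antisym)
  show "himp a (Inf B) \<le> (INF b\<in>B. himp a b)"
    by (meson INF_greatest Inf_lower inf_himp_le le_himp_iff order_trans)
  show "(INF b\<in>B. himp a b) \<le> himp a (Inf B)"
    unfolding le_himp_iff by (meson INF_lower Inf_greatest le_himp_iff)
qed

section \<open>Sublocales and their binary joins\<close>

lemma sublocale_Inf: "is_sublocale S \<Longrightarrow> A \<subseteq> S \<Longrightarrow> Inf A \<in> S"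
  by (simp add: is_sublocale_def)

lemma sublocale_himp: "is_sublocale S \<Longrightarrow> s \<in> S \<Longrightarrow> himp x s \<in> S"
  by (simp add: is_sublocale_def)

lemma sublocale_top: "is_sublocale S \<Longrightarrow> top \<in> S"
  using void_subset by (auto simp: void_def)

lemma Int_eq_void_iff:
  assumes "is_sublocale S" "is_sublocale T"
  shows "S \<inter> T = void \<longleftrightarrow> (\<forall>x. x \<in> S \<longrightarrow> x \<in> T \<longrightarrow> x = top)"
  using assms[THEN sublocale_top] by (auto simp: void_def)

lemma is_sublocale_Int: "is_sublocale S \<Longrightarrow> is_sublocale T \<Longrightarrow> is_sublocale (S \<inter> T)"
  by (auto intro: is_sublocale_Inter[of "{S, T}", simplified])

lemma is_sublocale_inf:
  assumes S: "is_sublocale S" and T: "is_sublocale T"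
  shows "is_sublocale {inf s t | s t. s \<in> S \<and> t \<in> T}" (is "is_sublocale ?J")
  unfolding is_sublocale_def
proof (intro conjI allI impI ballI)
  fix A assume A: "A \<subseteq> ?J"
  \<comment> \<open>\<open>P\<close> and \<open>Q\<close> collect the components of all
    decompositions of elements of \<open>A\<close>, so no decomposition has to be chosen.\<close>
  define P where "P = {s \<in> S. \<exists>t\<in>T. inf s t \<in> A}"
  define Q where "Q = {t \<in> T. \<exists>s\<in>S. inf s t \<in> A}"
  have "Inf A = inf (Inf P) (Inf Q)"
  proof (rule order.antisym)
    show "Inf A \<le> inf (Inf P) (Inf Q)"
      by (auto simp: P_def Q_def le_Inf_iff dest: Inf_lower)
    show "inf (Inf P) (Inf Q) \<le> Inf A"
    proof (rule Inf_greatest)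
      fix x assume "x \<in> A"
      with A obtain s t where "x = inf s t" "s \<in> P" "t \<in> Q"
        by (force simp: P_def Q_def)
      then show "inf (Inf P) (Inf Q) \<le> x"
        by (auto intro: le_infI1 le_infI2 Inf_lower)
    qed
  qed
  moreover have "Inf P \<in> S" "Inf Q \<in> T"
    using S T by (auto simp: P_def Q_def intro: sublocale_Inf)
  ultimately show "Inf A \<in> ?J" by blast
next
  fix x y assume "y \<in> ?J"
  then obtain s t where "y = inf s t" "s \<in> S" "t \<in> T" by blast
  then show "himp x y \<in> ?J"
    using S T by (auto simp: himp_inf intro: sublocale_himp)
qed

text \<open>Pairing with \<open>top\<close> places both sublocales inside the set of meets;
  conversely, a sublocale containing both is closed under binary meets. This makes covers usable
  elementwise.\<close>

lemma subl_Sup_pair: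
  assumes S: "is_sublocale S" and T: "is_sublocale T"
  shows "subl_Sup {S, T} = {inf s t | s t. s \<in> S \<and> t \<in> T}" (is "_ = ?J")
proof
  have "s \<in> ?J" if "s \<in> S" for s
    using that sublocale_top[OF T] by (metis (mono_tags, lifting) inf_top_right mem_Collect_eq)
  moreover have "t \<in> ?J" if "t \<in> T" for t
    using that sublocale_top[OF S] by (metis (mono_tags, lifting) inf_top_left mem_Collect_eq)
  ultimately show "subl_Sup {S, T} \<subseteq> ?J"
    by (intro subl_Sup_least is_sublocale_inf S T) auto
  have "inf s t \<in> subl_Sup {S, T}" if "s \<in> S" "t \<in> T" for s t
  proof -
    have "{s, t} \<subseteq> subl_Sup {S, T}"
      using that subl_Sup_upper[of S "{S, T}"] subl_Sup_upper[of T "{S, T}"] by auto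
    then show ?thesis
      using sublocale_Inf[OF is_sublocale_subl_Sup, of "{s, t}" "{S, T}"] by simp
  qed
  then show "?J \<subseteq> subl_Sup {S, T}" by blast
qed

text \<open>An elementwise substitute for distributing \<open>X\<close> over the join of
  \<open>S\<close> and \<open>T\<close>: splitting an element of \<open>X\<close> along the cover,
  disjointness from \<open>S\<close> makes the \<open>S\<close>-component redundant.\<close>

lemma disjoint_imp_subset:
  assumes S: "is_sublocale S" and T: "is_sublocale T" and X: "is_sublocale X"
    and cover: "subl_Sup {S, T} = UNIV" and disj: "X \<inter> S = void"
  shows "X \<subseteq> T"
proof
  fix x assume x: "x \<in> X"
  have "x \<in> {inf s t | s t. s \<in> S \<and> t \<in> T}"
    using cover subl_Sup_pair[OF S T] by auto
  then obtain s t where st: "x = inf s t" "s \<in> S" "t \<in> T" by blast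
  \<comment> \<open>This element lies in \<open>X\<close> because \<open>x\<close> does, and in
    \<open>S\<close> because \<open>s\<close> does.\<close>
  have "himp t x = himp t s"
    unfolding st(1) by (rule himp_eqI) (simp add: le_infI1)
  then have "himp t x \<in> X \<inter> S"
    using X S x st(2) by (metis IntI sublocale_himp)
  then have "himp t x = top"
    using disj by (simp add: void_def)
  then have "t \<le> x"
    by (metis le_himp_iff inf_top_right top_greatest)
  then show "x \<in> T"
    using st by (metis inf.cobounded2 order.antisym)
qed

section \<open>Open and closed sublocales as complements\<close>

lemma mem_open_subl_iff: "x \<in> open_subl a \<longleftrightarrow> himp a x = x"
proof
  assume "x \<in> open_subl a"
  \<comment> \<open>The map \<open>himp a\<close> is idempotent, so its image is its set of fixed
    points.\<close>
  then show "himp a x = x"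
    by (auto simp: open_subl_def himp_himp)
next
  assume "himp a x = x"
  then show "x \<in> open_subl a"
    unfolding open_subl_def by (metis (mono_tags) mem_Collect_eq)
qed

lemma is_sublocale_open: "is_sublocale (open_subl a)"
  unfolding is_sublocale_def
proof (intro conjI allI impI ballI)
  fix A assume "A \<subseteq> open_subl a"
  then have "(\<lambda>b. himp a b) ` A = A"
    by (force simp: mem_open_subl_iff subset_iff)
  then show "Inf A \<in> open_subl a"
    by (simp add: mem_open_subl_iff himp_Inf)
next
  fix x s assume "s \<in> open_subl a"
  then show "himp x s \<in> open_subl a"
    by (metis mem_open_subl_iff himp_himp inf.commute)
qed

lemma is_sublocale_closed: "is_sublocale (closed_subl a)"
  by (auto simp: is_sublocale_def closed_subl_def le_Inf_iff intro: order_trans[OF _ le_himp])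

lemma open_Int_closed: "open_subl a \<inter> closed_subl a = void"
proof -
  have "x = top" if "himp a x = x" "a \<le> x" for x
    using that by (metis le_himp_iff inf.coboundedI1 top_le)
  then show ?thesis
    unfolding Int_eq_void_iff[OF is_sublocale_open is_sublocale_closed]
    by (simp add: mem_open_subl_iff closed_subl_def)
qed

lemma open_join_closed: "subl_Sup {open_subl a, closed_subl a} = UNIV"
proof -
  have "x = inf (himp a x) (sup a x)" for x
  proof (rule order.antisym)
    \<comment> \<open>Both \<open>a\<close> and \<open>x\<close> lie below
      \<open>himp (himp a x) x\<close>, hence so does their join.\<close>
    have "a \<le> himp (himp a x) x"
      using inf_himp_le[of a x] by (simp add: le_himp_iff inf.commute)
    then have "sup a x \<le> himp (himp a x) x"
      by (simp add: le_himp)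
    then show "inf (himp a x) (sup a x) \<le> x"
      by (simp only: le_himp_iff)
  qed (simp add: le_himp)
  moreover have "himp a x \<in> open_subl a" "sup a x \<in> closed_subl a" for x
    by (auto simp: open_subl_def closed_subl_def)
  ultimately show ?thesis
    unfolding subl_Sup_pair[OF is_sublocale_open is_sublocale_closed] by blast
qed

lemma disjoint_open_iff:
  assumes "is_sublocale X"
  shows "X \<inter> open_subl a = void \<longleftrightarrow> X \<subseteq> closed_subl a"
proof
  show "X \<inter> open_subl a = void \<Longrightarrow> X \<subseteq> closed_subl a"
    using assms is_sublocale_open is_sublocale_closed open_join_closed disjoint_imp_subset by blast
  show "X \<subseteq> closed_subl a \<Longrightarrow> X \<inter> open_subl a = void"
    using void_subset[OF is_sublocale_Int[OF assms is_sublocale_open]] open_Int_closed by blast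
qed

lemma disjoint_closed_imp_subset_open:
  assumes "is_sublocale X" "X \<inter> closed_subl a = void"
  shows "X \<subseteq> open_subl a"
  using assms open_join_closed[of a]
  by (intro disjoint_imp_subset[OF is_sublocale_closed is_sublocale_open]) (simp_all add: insert_commute)

text \<open>Both inclusions say that the two open sublocales are disjoint.\<close>

lemma open_subset_closed_commute:
  "open_subl a \<subseteq> closed_subl b \<longleftrightarrow> open_subl b \<subseteq> closed_subl a"
  using disjoint_open_iff[OF is_sublocale_open, of a b]
    disjoint_open_iff[OF is_sublocale_open, of b a]
  by (simp add: Int_commute)

lemma open_subl_bot: "open_subl bot = void"
proof -
  have "himp bot x = top" for x :: 'a
    by (rule top_le) (simp add: le_himp_iff)
  then show ?thesis by (auto simp: open_subl_def void_def)
qed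

lemma open_subl_top: "open_subl top = UNIV"
  by (auto simp: mem_open_subl_iff le_himp intro!: order.antisym)
    (metis inf_himp_le inf_top_left)

lemma open_subl_eq_void_iff: "open_subl a = void \<longleftrightarrow> a = bot"
proof
  assume "open_subl a = void"
  then have "himp a bot = top"
    by (auto simp: open_subl_def void_def)
  then show "a = bot"
    by (metis inf_himp_le inf_top_right bot.extremum_uniqueI)
qed (simp add: open_subl_bot)

section \<open>Supplements\<close>

lemma is_sublocale_supplement: "is_sublocale (supplement S)"
  by (simp add: supplement_def is_sublocale_subl_Sup)

lemma supplement_join:
  assumes S: "is_sublocale S"
  shows "subl_Sup {S, supplement S} = UNIV"
proof -
  have "\<exists>s\<in>S. \<exists>t\<in>supplement S. x = inf s t" for x
  proof -
    \<comment> \<open>\<open>s\<close> is the least element of \<open>S\<close> above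
      \<open>x\<close>. Elements of \<open>S\<close> above \<open>x\<close> are therefore above
      \<open>s\<close>, so those in \<open>open_subl s\<close> equal \<open>top\<close>; this makes
      \<open>T\<close> disjoint from \<open>S\<close>.\<close>
    define s where "s = Inf {s \<in> S. x \<le> s}"
    define T where "T = closed_subl x \<inter> open_subl s"
    have s: "s \<in> S" "x \<le> s"
      using S by (auto simp: s_def le_Inf_iff intro: sublocale_Inf)
    have T: "is_sublocale T"
      by (simp add: T_def is_sublocale_Int is_sublocale_closed is_sublocale_open)
    have "y = top" if "y \<in> T" "y \<in> S" for y
    proof -
      have "s \<le> y"
        using that by (auto simp: s_def T_def closed_subl_def intro: Inf_lower)
      then have "y \<in> open_subl s \<inter> closed_subl s"
        using that by (simp add: T_def closed_subl_def)
      then show ?thesis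
        by (simp add: open_Int_closed void_def)
    qed
    then have "T \<inter> S = void"
      using S T by (simp add: Int_eq_void_iff)
    then have "T \<subseteq> supplement S"
      unfolding supplement_def using T by (intro subl_Sup_upper) simp
    moreover have "himp s x \<in> T"
      by (auto simp: T_def closed_subl_def open_subl_def le_himp)
    moreover have "x = inf s (himp s x)"
      using s by (intro order.antisym) (simp_all add: le_himp inf_himp_le)
    ultimately show ?thesis
      using s by blast
  qed
  then show ?thesis
    unfolding subl_Sup_pair[OF S is_sublocale_supplement] by blast
qed

text \<open>The left side says that the supplement misses \<open>open_subl b\<close>, and
  \<open>S\<close> together with its supplement covers the locale. Read for all \<open>b\<close> in
  a subframe, this matches density of the supplement with voidness of the interior.\<close>

lemma supplement_subset_closed_iff:
  assumes S: "is_sublocale S"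
  shows "supplement S \<subseteq> closed_subl b \<longleftrightarrow> open_subl b \<subseteq> S"
proof
  assume sub: "supplement S \<subseteq> closed_subl b"
  have "open_subl b \<inter> supplement S = void"
    using sub disjoint_open_iff[OF is_sublocale_supplement, of S b] by (simp add: Int_commute)
  then show "open_subl b \<subseteq> S"
    using S supplement_join[OF S]
    by (intro disjoint_imp_subset[of "supplement S"])
      (simp_all add: insert_commute is_sublocale_open is_sublocale_supplement)
next
  assume sub: "open_subl b \<subseteq> S"
  have "T \<subseteq> closed_subl b" if T: "is_sublocale T" "T \<inter> S = void" for T
  proof -
    have "T \<inter> open_subl b = void"
      using T sub void_subset[OF is_sublocale_Int[OF T(1) is_sublocale_open]] by blast
    then show ?thesis
      using T(1) by (simp add: disjoint_open_iff)
  qed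
  then show "supplement S \<subseteq> closed_subl b"
    unfolding supplement_def by (intro subl_Sup_least is_sublocale_closed) simp
qed

section \<open>Density, interior and closure tested on elements of a subframe\<close>

lemma k_dense_iff: "k_dense M S \<longleftrightarrow> (\<forall>a\<in>M. S \<subseteq> closed_subl a \<longrightarrow> a = bot)"
proof -
  have "closed_subl a = UNIV \<longleftrightarrow> a = bot" for a :: 'a
    unfolding closed_subl_def by (metis UNIV_I bot.extremum bot.extremum_uniqueI mem_Collect_eq UNIV_eq_I)
  then show ?thesis
    by (auto simp: k_dense_def k_closure_def)
qed

lemma k_interior_void_iff:
  "k_interior M S = void \<longleftrightarrow> (\<forall>a\<in>M. open_subl a \<subseteq> S \<longrightarrow> a = bot)"
proof
  assume void: "k_interior M S = void"
  show "\<forall>a\<in>M. open_subl a \<subseteq> S \<longrightarrow> a = bot"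
  proof (intro ballI impI)
    fix a assume "a \<in> M" "open_subl a \<subseteq> S"
    then have "open_subl a \<subseteq> void"
      unfolding void[symmetric] k_interior_def by (intro subl_Sup_upper) blast
    then show "a = bot"
      using void_subset[OF is_sublocale_open] by (metis open_subl_eq_void_iff subset_antisym)
  qed
next
  assume "\<forall>a\<in>M. open_subl a \<subseteq> S \<longrightarrow> a = bot"
  then have "k_interior M S \<subseteq> void"
    unfolding k_interior_def
    by (intro subl_Sup_least is_sublocale_void) (auto simp: open_subl_bot)
  then show "k_interior M S = void"
    unfolding k_interior_def by (intro subset_antisym void_subset is_sublocale_subl_Sup)
qed

lemma k_interior_closed_void_iff:
  "k_interior M (closed_subl a) = void \<longleftrightarrow> k_dense M (open_subl a)"
  unfolding k_interior_void_iff k_dense_iff open_subset_closed_commute[of _ a] ..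

text \<open>An intersection of closed sublocales is the closed sublocale of the join, and a subframe
  contains its joins.\<close>

lemma k_closure_eq_closed:
  assumes "subframe M"
  obtains a where "a \<in> M" "k_closure M S = closed_subl a"
proof
  show "Sup {a \<in> M. S \<subseteq> closed_subl a} \<in> M"
    using assms by (simp add: subframe_def)
  show "k_closure M S = closed_subl (Sup {a \<in> M. S \<subseteq> closed_subl a})"
    by (auto simp: k_closure_def closed_subl_def Sup_le_iff)
qed

lemma subset_k_closure: "S \<subseteq> k_closure M S"
  by (auto simp: k_closure_def)

section \<open>Nowhere density and category\<close>

lemma nowhere_dense_closed:
  assumes a: "a \<in> Mj" and dense: "k_dense Mi (open_subl a)"
  shows "nowhere_dense Mj Mi (closed_subl a)"
proof -
  have "k_closure Mj (closed_subl a) = closed_subl a"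
    using a subset_k_closure[of "closed_subl a" Mj] by (auto simp: k_closure_def)
  then show ?thesis
    using dense by (simp add: nowhere_dense_def is_sublocale_closed k_interior_closed_void_iff)
qed

lemma nowhere_dense_subset_closed:
  assumes "subframe Mj" "nowhere_dense Mj Mi S"
  obtains a where "a \<in> Mj" "k_dense Mi (open_subl a)" "S \<subseteq> closed_subl a"
proof -
  obtain a where "a \<in> Mj" "k_closure Mj S = closed_subl a"
    using k_closure_eq_closed[OF assms(1)] .
  with assms(2) subset_k_closure[of S Mj] show thesis
    by (intro that[of a]) (auto simp: nowhere_dense_def k_interior_closed_void_iff)
qed

lemma first_category_mono:
  "first_category Mj Mi S \<Longrightarrow> is_sublocale T \<Longrightarrow> T \<subseteq> S \<Longrightarrow> first_category Mj Mi T"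
  unfolding first_category_def by (meson order_trans)

lemma second_category_iff_interior_void:
  "(\<forall>S. k_open Mi S \<and> S \<noteq> void \<longrightarrow> second_category Mj Mi S) \<longleftrightarrow>
   (\<forall>S. first_category Mj Mi S \<longrightarrow> k_interior Mi S = void)" (is "?second \<longleftrightarrow> ?interior")
proof
  assume second: ?second
  show ?interior
    unfolding k_interior_void_iff
  proof (intro allI impI ballI)
    \<comment> \<open>The open sublocale inherits first category from \<open>S\<close>, so it must
      be void.\<close>
    fix S a assume "first_category Mj Mi S" "a \<in> Mi" "open_subl a \<subseteq> S"
    then show "a = bot"
      using second first_category_mono[OF _ is_sublocale_open]
      by (metis k_open_def open_subl_eq_void_iff second_category_def)
  qed
next
  assume ?interior
  \<comment> \<open>An open sublocale of first category lies in its own interior.\<close>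
  then show ?second
    unfolding k_open_def k_interior_void_iff second_category_def
    using is_sublocale_open open_subl_bot by blast
qed

lemma interior_void_iff_supplement_dense:
  "is_sublocale S \<Longrightarrow> k_interior M S = void \<longleftrightarrow> k_dense M (supplement S)"
  by (simp add: k_interior_void_iff k_dense_iff supplement_subset_closed_iff)

lemma baire_imp_interior_void:
  assumes Mj: "subframe Mj"
    and compl: "\<And>S. k_Gdelta Mj S \<Longrightarrow> complemented_sublocale S"
    and baire: "baire Mi Mj" and S: "first_category Mj Mi S"
  shows "k_interior Mi S = void"
  unfolding k_interior_void_iff
proof (intro ballI impI)
  fix b assume b: "b \<in> Mi" "open_subl b \<subseteq> S"
  obtain N :: "nat \<Rightarrow> 'a set" where N: "\<And>n. nowhere_dense Mj Mi (N n)" "S \<subseteq> subl_Sup (range N)"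
    using S by (auto simp: first_category_def)
  have "\<exists>a. a \<in> Mj \<and> k_dense Mi (open_subl a) \<and> N n \<subseteq> closed_subl a" for n
    using nowhere_dense_subset_closed[OF Mj N(1)] by metis
  then obtain a where a: "\<And>n. a n \<in> Mj" "\<And>n. k_dense Mi (open_subl (a n))"
      "\<And>n. N n \<subseteq> closed_subl (a n)"
    by metis
  define G where "G = (\<Inter>n. open_subl (a n))"
  have dense: "k_dense Mi G"
    using baire[unfolded baire_def, rule_format, of "range (\<lambda>n. open_subl (a n))"] a
    by (auto simp: G_def k_open_def)
  have "complemented_sublocale G"
    using a(1) unfolding G_def by (intro compl[unfolded k_Gdelta_def] exI[of _ a]) auto
  then obtain T where G: "is_sublocale G" and T: "is_sublocale T" "G \<inter> T = void"
      "subl_Sup {G, T} = UNIV"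
    by (auto simp: complemented_sublocale_def)
  \<comment> \<open>Complementedness of \<open>G\<close> enters here: the single sublocale
    \<open>T\<close> contains every \<open>closed_subl (a n)\<close>, hence their infinite join,
    while still missing \<open>G\<close>.\<close>
  have "closed_subl (a n) \<subseteq> T" for n
  proof (rule disjoint_imp_subset[OF G T(1) is_sublocale_closed T(3)])
    show "closed_subl (a n) \<inter> G = void"
      using open_Int_closed[of "a n"] void_subset[OF G] void_subset[OF is_sublocale_closed]
      unfolding G_def by blast
  qed
  then have "subl_Sup (range N) \<subseteq> T"
    using a(3) by (intro subl_Sup_least T(1)) blast
  then have "open_subl b \<subseteq> T"
    using b(2) N(2) by blast
  then have "G \<inter> open_subl b = void"
    using T(2) void_subset[OF is_sublocale_Int[OF G is_sublocale_open]] by blast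
  \<comment> \<open>Disjointness from \<open>open_subl b\<close> means that \<open>G\<close> lies in
    \<open>closed_subl b\<close>, which density of \<open>G\<close> permits for \<open>bot\<close>
    alone.\<close>
  then show "b = bot"
    using dense b(1) G by (simp add: k_dense_iff disjoint_open_iff)
qed

lemma supplement_dense_imp_baire:
  assumes Mj: "subframe Mj"
    and dense: "\<And>S. first_category Mj Mi S \<Longrightarrow> k_dense Mi (supplement S)"
  shows "baire Mi Mj"
  unfolding baire_def
proof (intro allI impI)
  fix \<S> assume \<S>: "countable \<S> \<and> (\<forall>S\<in>\<S>. k_dense Mi S \<and> k_open Mj S)"
  \<comment> \<open>Adding the whole locale makes the family nonempty without changing its intersection.\<close>
  have "Inf {} \<in> Mj"
    using Mj by (metis empty_subsetI finite.emptyI subframe_def)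
  then have "k_open Mj UNIV"
    by (auto simp: k_open_def open_subl_top intro!: bexI[of _ top])
  moreover have "k_dense Mi UNIV"
    by (auto simp: k_dense_def k_closure_def)
  ultimately have ins: "\<forall>S\<in>insert UNIV \<S>. k_dense Mi S \<and> k_open Mj S"
    using \<S> by blast
  obtain U :: "nat \<Rightarrow> 'a set" where U: "insert UNIV \<S> = range U"
    using \<S> uncountable_def[of "insert UNIV \<S>"] by auto
  have "\<exists>a\<in>Mj. U n = open_subl a \<and> k_dense Mi (open_subl a)" for n
    using ins U by (metis k_open_def rangeI)
  then obtain a where a: "\<And>n. a n \<in> Mj" "\<And>n. U n = open_subl (a n)"
      "\<And>n. k_dense Mi (open_subl (a n))"
    by metis
  define S where "S = subl_Sup (range (\<lambda>n. closed_subl (a n)))"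
  have S: "is_sublocale S"
    by (simp add: S_def is_sublocale_subl_Sup)
  have "first_category Mj Mi S"
    unfolding first_category_def S_def
    by (intro conjI is_sublocale_subl_Sup exI[of _ "\<lambda>n. closed_subl (a n)"] allI
        nowhere_dense_closed a order_refl)
  then have dense_S: "k_dense Mi (supplement S)"
    by (rule dense)
  \<comment> \<open>A sublocale missing the join \<open>S\<close> misses each
    \<open>closed_subl (a n)\<close> below it.\<close>
  have "T \<subseteq> open_subl (a n)" if T: "is_sublocale T" "T \<inter> S = void" for T n
  proof (rule disjoint_closed_imp_subset_open[OF T(1)])
    have "closed_subl (a n) \<subseteq> S"
      unfolding S_def by (intro subl_Sup_upper) simp
    then show "T \<inter> closed_subl (a n) = void"
      using T void_subset[OF is_sublocale_Int[OF T(1) is_sublocale_closed]] by blast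
  qed
  then have "supplement S \<subseteq> open_subl (a n)" for n
    unfolding supplement_def by (intro subl_Sup_least is_sublocale_open) simp
  then have "supplement S \<subseteq> \<Inter>(insert UNIV \<S>)"
    unfolding U a(2)[abs_def] by (auto simp: a(2))
  \<comment> \<open>Density passes to larger sets.\<close>
  then show "k_dense Mi (\<Inter>\<S>)"
    using dense_S unfolding k_dense_iff by auto
qed

theorem theorem2p6:
  fixes L :: "nat \<Rightarrow> 'a::frame set" and i j :: nat
  assumes "{i, j} = {1, 2}"
    and "bilocale (L 1) (L 2)"
    and "\<And>S. k_Gdelta (L j) S \<Longrightarrow> complemented_sublocale S"
  shows "(baire (L i) (L j) \<longleftrightarrow>
            (\<forall>S. k_open (L i) S \<and> S \<noteq> void \<longrightarrow> second_category (L j) (L i) S))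
       \<and> ((\<forall>S. k_open (L i) S \<and> S \<noteq> void \<longrightarrow> second_category (L j) (L i) S) \<longleftrightarrow>
            (\<forall>S. first_category (L j) (L i) S \<longrightarrow> k_interior (L i) S = void))
       \<and> ((\<forall>S. first_category (L j) (L i) S \<longrightarrow> k_interior (L i) S = void) \<longleftrightarrow>
            (\<forall>S. first_category (L j) (L i) S \<longrightarrow> k_dense (L i) (supplement S)))"
proof -
  have Lj: "subframe (L j)"
    using assms(1,2) by (auto simp: bilocale_def doubleton_eq_iff)
  have "(\<forall>S. first_category (L j) (L i) S \<longrightarrow> k_interior (L i) S = void) \<longleftrightarrow>
      (\<forall>S. first_category (L j) (L i) S \<longrightarrow> k_dense (L i) (supplement S))" (is "?interior \<longleftrightarrow> ?dense")
    by (auto simp: first_category_def interior_void_iff_supplement_dense)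
  moreover have "baire (L i) (L j) \<Longrightarrow> ?interior"
    using baire_imp_interior_void[OF Lj assms(3)] by blast
  moreover have "?dense \<Longrightarrow> baire (L i) (L j)"
    using supplement_dense_imp_baire[OF Lj] by blast
  \<comment> \<open>The second category condition is rewritten as the interior condition; the
    remaining implications form a cycle through \<open>baire\<close>, \<open>?interior\<close> and
    \<open>?dense\<close>.\<close>
  ultimately show ?thesis
    unfolding second_category_iff_interior_void by blast
qed

end
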